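(* Let $(L,\triangleright,[\cdot,\cdot])$ be a post-Lie algebra and let $\diamond:L\otimes L\to L$ be a bilinear operation. Suppose that - $\diamond\,\mathbf{T}^{\diamond,[\cdot,\cdot]}\equiv 0$ and $\mathbf{R}^{\diamond,[\cdot,\cdot]}\equiv 0$; - for every $x\in L$, the map $x\triangleright\cdot$ is a derivation of $(L,\diamond)$, i.e. $x\triangleright(y\diamond z)=(x\triangleright y)\diamond z+y\diamond(x\triangleright z)$ for all $y,z\in L$. Put $x\blacktriangleright y:=x\triangleright y+x\diamond y$ and $[x,y]^{\mathrm d}:=[x,y]-[x,y]_\diamond=-\mathbf{T}^{\diamond,[\cdot,\cdot]}(x,y)$. Then $(L,\blacktriangleright,[\cdot,\cdot]^{\mathrm d})$ is a post-Lie algebra.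
   Context: Vector spaces are over $\mathbb{R}$. For a bilinear operation $\ast$ on a vector space $L$: $[x,y]_\ast:=x\ast y-y\ast x$ and $\mathsf{a}_\ast(x,y,z):=x\ast(y\ast z)-(x\ast y)\ast z$. A (left) post-Lie algebra $(L,\triangleright,[\cdot,\cdot])$ is a vector space with bilinear operations $\triangleright,[\cdot,\cdot]$ such that $[\cdot,\cdot]$ is a Lie bracket and, for all $x,y,z$: $x\triangleright[y,z]=[x\triangleright y,z]+[y,x\triangleright z]$ and $[x,y]\triangleright z=\mathsf{a}_\triangleright(x,y,z)-\mathsf{a}_\triangleright(y,x,z)$. For a bilinear operation $\diamond$ on a Lie algebra $(L,[\cdot,\cdot])$, the torsion and curvature are $\mathbf{T}^{\diamond,[\cdot,\cdot]}(x,y):=[x,y]_\diamond-[x,y]$ and $\mathbf{R}^{\diamond,[\cdot,\cdot]}(x,y,z):=x\diamond(y\diamond z)-y\diamond(x\diamond z)-[x,y]\diamond z$. For a bilinear map $\mathbf{T}:L\otimes L\to L$ the $\diamond$-covariant derivative is $(x\diamond\mathbf{T})(y,z):=x\diamond(\mathbf{T}(y,z))-\mathbf{T}(x\diamond y,z)-\mathbf{T}(y,x\diamond z)$; $\diamond\,\mathbf{T}\equiv0$ means $(x\diamond\mathbf{T})(y,z)=0$ for all $x,y,z\in L$. *)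

theory Defs
  imports "HOL-Analysis.Analysis"
begin

definition commutator :: "('a \<Rightarrow> 'a \<Rightarrow> 'a) \<Rightarrow> 'a \<Rightarrow> 'a \<Rightarrow> 'a::real_vector"
  where "commutator m x y = m x y - m y x"

text \<open>The sign is opposite to the other common convention \<open>(x y) z - x (y z)\<close>.\<close>

definition associator :: "('a \<Rightarrow> 'a \<Rightarrow> 'a) \<Rightarrow> 'a \<Rightarrow> 'a \<Rightarrow> 'a \<Rightarrow> 'a::real_vector"
  where "associator m x y z = m x (m y z) - m (m x y) z"

locale lie_algebra =
  fixes bracket :: "'a \<Rightarrow> 'a \<Rightarrow> 'a::real_vector"
  assumes bilinear_bracket: "bilinear bracket"
    and bracket_self: "bracket x x = 0"
    and jacobi: "bracket x (bracket y z) + bracket y (bracket z x) + bracket z (bracket x y) = 0"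

locale post_lie_algebra = lie_algebra bracket
  for tri bracket :: "'a \<Rightarrow> 'a \<Rightarrow> 'a::real_vector" +
  assumes bilinear_tri: "bilinear tri"
    and tri_bracket: "tri x (bracket y z) = bracket (tri x y) z + bracket y (tri x z)"
    and bracket_tri: "tri (bracket x y) z = associator tri x y z - associator tri y x z"

definition torsion ::
    "('a \<Rightarrow> 'a \<Rightarrow> 'a) \<Rightarrow> ('a \<Rightarrow> 'a \<Rightarrow> 'a) \<Rightarrow> 'a \<Rightarrow> 'a \<Rightarrow> 'a::real_vector"
  where "torsion dia bracket x y = commutator dia x y - bracket x y"

definition curvature ::
    "('a \<Rightarrow> 'a \<Rightarrow> 'a) \<Rightarrow> ('a \<Rightarrow> 'a \<Rightarrow> 'a) \<Rightarrow> 'a \<Rightarrow> 'a \<Rightarrow> 'a \<Rightarrow> 'a::real_vector"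
  where "curvature dia bracket x y z = dia x (dia y z) - dia y (dia x z) - dia (bracket x y) z"

text \<open>\<open>covariant_derivative dia T x y z\<close> is \<open>(x \<diamondop> T)(y, z)\<close>, where \<open>\<diamondop>\<close> is \<open>dia\<close>.\<close>

definition covariant_derivative ::
    "('a \<Rightarrow> 'a \<Rightarrow> 'a) \<Rightarrow> ('a \<Rightarrow> 'a \<Rightarrow> 'a) \<Rightarrow> 'a \<Rightarrow> 'a \<Rightarrow> 'a \<Rightarrow> 'a::real_vector"
  where "covariant_derivative dia T x y z = dia x (T y z) - T (dia x y) z - T y (dia x z)"

definition bracket_d ::
    "('a \<Rightarrow> 'a \<Rightarrow> 'a) \<Rightarrow> ('a \<Rightarrow> 'a \<Rightarrow> 'a) \<Rightarrow> 'a \<Rightarrow> 'a \<Rightarrow> 'a::real_vector"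
  where "bracket_d dia bracket x y = bracket x y - commutator dia x y"

lemma bracket_d_eq_minus_torsion: "bracket_d dia bracket x y = - torsion dia bracket x y"
  by (simp add: bracket_d_def torsion_def)

end

theory Submission
  imports Defs
begin

text \<open>For a torsion-parallel flat connection, the Jacobi identity of the torsion is the first
  Bianchi identity. The connection \<open>\<lambda>x y. tri x y + dia x y\<close> inherits the derivation
  property summand by summand. Its compatibility with the new bracket says that
  \<open>x \<mapsto> tri x + dia x\<close> represents the bracket
  \<open>bracket x y + commutator tri x y\<close>, which is unchanged by the passage from \<open>tri\<close> to
  \<open>tri + dia\<close> because the contribution of \<open>dia\<close> to the commutator cancels the change of the Lie
  bracket.\<close>

lemma bilinear_bracket_d:
  assumes "bilinear bracket" "bilinear dia"
  shows "bilinear (bracket_d dia bracket)"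
  unfolding bilinear_def
proof (intro conjI allI linearI)
qed (simp_all add: bracket_d_def commutator_def algebra_simps
      bilinear_ladd[OF assms(1)] bilinear_radd[OF assms(1)] bilinear_lmul[OF assms(1)]
      bilinear_rmul[OF assms(1)] bilinear_ladd[OF assms(2)] bilinear_radd[OF assms(2)]
      bilinear_lmul[OF assms(2)] bilinear_rmul[OF assms(2)])

lemma bilinear_add:
  assumes "bilinear f" "bilinear g"
  shows "bilinear (\<lambda>x y. f x y + g x y)"
  using assms unfolding bilinear_def by (simp add: linear_compose_add)

text \<open>A vanishing covariant derivative is a Leibniz rule for \<open>dia x\<close> on the
  torsion, and a change of sign preserves it.\<close>

lemma bracket_d_parallel:
  assumes "bilinear dia"
    and "covariant_derivative dia (torsion dia bracket) x y z = 0"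
  shows "dia x (bracket_d dia bracket y z) =
    bracket_d dia bracket (dia x y) z + bracket_d dia bracket y (dia x z)"
  using assms(2)
  by (simp add: covariant_derivative_def bracket_d_eq_minus_torsion bilinear_rneg[OF assms(1)]
      algebra_simps)

text \<open>A derivation of \<open>dia\<close> also obeys the Leibniz rule for the commutator of
  \<open>dia\<close>, and this rule passes to differences of products.\<close>

lemma bracket_d_derivation:
  assumes "linear (d :: 'a::real_vector \<Rightarrow> 'a)"
    and "d (bracket y z) = bracket (d y) z + bracket y (d z)"
    and "\<And>u v. d (dia u v) = dia (d u) v + dia u (d v)"
  shows "d (bracket_d dia bracket y z) =
    bracket_d dia bracket (d y) z + bracket_d dia bracket y (d z)"
  by (simp add: bracket_d_def commutator_def linear_diff[OF assms(1)] assms(2,3))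

lemma lie_algebra_bracket_d:
  assumes "lie_algebra bracket" and "bilinear dia"
    and parallel: "\<And>x y z. covariant_derivative dia (torsion dia bracket) x y z = 0"
    and flat: "\<And>x y z. curvature dia bracket x y z = 0"
  shows "lie_algebra (bracket_d dia bracket)"
proof -
  interpret lie_algebra bracket by fact
  let ?D = "bracket_d dia bracket"
  have bil: "bilinear ?D"
    by (rule bilinear_bracket_d[OF bilinear_bracket assms(2)])
  have self: "?D x x = 0" for x
    by (simp add: bracket_d_def commutator_def bracket_self)
  have skew: "?D x y = - ?D y x" for x y
  proof -
    \<comment> \<open>Polarization of the alternating law.\<close>
    have "?D (x + y) (x + y) = ?D x y + ?D y x"
      unfolding bilinear_ladd[OF bil] bilinear_radd[OF bil] by (simp add: self)
    then show ?thesis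
      by (metis self eq_neg_iff_add_eq_0)
  qed
  \<comment> \<open>Flatness has replaced \<open>dia (bracket y z) x\<close>.\<close>
  have D_bracket: "?D x (bracket y z) = bracket x (bracket y z) - dia x (bracket y z)
      + (dia y (dia z x) - dia z (dia y x))" for x y z
    using flat[of y z x] by (simp add: bracket_d_def commutator_def curvature_def)
  \<comment> \<open>Only the inner bracket is expanded: the terms \<open>?D x (dia y z)\<close> stay
    intact to cancel against those that parallelism produces.\<close>
  have D_D: "?D x (?D y z) = ?D x (bracket y z) - ?D x (dia y z) + ?D x (dia z y)" for x y z
    by (simp add: bracket_d_def[of _ _ y z] commutator_def bilinear_rsub[OF bil])
  have dia_bracket: "dia x (bracket y z) =
      dia x (dia y z) - dia x (dia z y) - ?D z (dia x y) + ?D y (dia x z)" for x y z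
  proof -
    have "dia x (?D y z) = - ?D z (dia x y) + ?D y (dia x z)"
      using bracket_d_parallel[OF assms(2) parallel, of x y z] skew[of "dia x y" z] by simp
    then show ?thesis
      by (simp add: bracket_d_def[of _ _ y z] commutator_def bilinear_radd[OF assms(2)]
          bilinear_rsub[OF assms(2)] algebra_simps)
  qed
  have "?D x (?D y z) + ?D y (?D z x) + ?D z (?D x y) = 0" for x y z
  proof -
    have "?D x (?D y z) + ?D y (?D z x) + ?D z (?D x y) =
        bracket x (bracket y z) + bracket y (bracket z x) + bracket z (bracket x y)"
      \<comment> \<open>In the cyclic sum the iterated \<open>dia\<close> terms cancel, and so do
        the terms with \<open>dia\<close> inside \<open>?D\<close>; only the Jacobi sum of
        \<open>bracket\<close> survives.\<close>
      unfolding D_D D_bracket dia_bracket by simp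
    then show ?thesis
      by (simp only: jacobi)
  qed
  with bil self show ?thesis
    by unfold_locales auto
qed

theorem theorem2p11:
  fixes tri bracket dia :: "'a \<Rightarrow> 'a \<Rightarrow> 'a::real_vector"
  assumes "post_lie_algebra tri bracket"
    and "bilinear dia"
    and "\<forall>x y z. covariant_derivative dia (torsion dia bracket) x y z = 0"
    and "\<forall>x y z. curvature dia bracket x y z = 0"
    and "\<forall>x y z. tri x (dia y z) = dia (tri x y) z + dia y (tri x z)"
  shows "post_lie_algebra (\<lambda>x y. tri x y + dia x y) (bracket_d dia bracket)"
proof -
  interpret post_lie_algebra tri bracket by fact
  let ?D = "bracket_d dia bracket"
  interpret D: lie_algebra ?D
    using assms by (intro lie_algebra_bracket_d lie_algebra_axioms) auto
  note t = bilinear_tri and d = assms(2)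
  note bil = bilinear_ladd[OF t] bilinear_radd[OF t] bilinear_lsub[OF t] bilinear_rsub[OF t]
    bilinear_ladd[OF d] bilinear_radd[OF d] bilinear_lsub[OF d] bilinear_rsub[OF d]
  have lin: "linear (tri x)" for x
    using t by (simp add: bilinear_def)
  show ?thesis
  proof
    show "bilinear (\<lambda>x y. tri x y + dia x y)"
      by (rule bilinear_add[OF t d])
    show "tri x (?D y z) + dia x (?D y z) =
      ?D (tri x y + dia x y) z + ?D y (tri x z + dia x z)" for x y z
    proof -
      have "tri x (?D y z) = ?D (tri x y) z + ?D y (tri x z)"
        using assms(5) by (intro bracket_d_derivation lin tri_bracket) blast
      moreover have "dia x (?D y z) = ?D (dia x y) z + ?D y (dia x z)"
        using assms(3) by (intro bracket_d_parallel d) blast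
      ultimately show ?thesis
        by (simp add: bilinear_ladd[OF D.bilinear_bracket] bilinear_radd[OF D.bilinear_bracket])
    qed
    show "tri (?D x y) z + dia (?D x y) z =
      associator (\<lambda>x y. tri x y + dia x y) x y z - associator (\<lambda>x y. tri x y + dia x y) y x z"
      for x y z
    proof -
      have "dia (bracket x y) z = dia x (dia y z) - dia y (dia x z)"
        using assms(4) by (simp add: curvature_def)
      \<comment> \<open>The mixed terms match by the derivation property:
        \<open>tri x (dia y z) - dia y (tri x z)\<close> is \<open>dia (tri x y) z\<close>, and
        likewise with x and y exchanged.\<close>
      then show ?thesis
        using bracket_tri[of x y z] assms(5)
        by (simp add: bracket_d_def commutator_def associator_def bil)
    qed
  qed
qed

end
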